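(* For all integers $2\le k\le t$, we have $$\delta_{k-1}^{\mathsf{HF}}(k,t)\;\le\; f_k(t) := 1-\frac{1}{\binom{t-1}{k-1}+\binom{t-2}{k-2}}.$$
   Context: A $k$-graph is a $k$-uniform hypergraph. The minimum $d$-degree $\delta_d(G)$ of a $k$-graph $G$ is the maximum $m$ such that every set of $d$ vertices is contained in at least $m$ edges. Connectivity. The line graph $L(G)$ of a $k$-graph $G$ is the $2$-graph with vertex set $E(G)$ and an edge $ef$ whenever $|e\cap f| = k-1$. A subgraph of $G$ is tightly connected if it has no isolated vertices and its edges induce a connected subgraph of $L(G)$. Edge-maximal tightly connected subgraphs are called tight components. Space. A fractional matching of an $n$-vertex $k$-graph $G$ is a function $\omega : E(G)\to[0,1]$ with $\sum_{e \ni v}\omega(e)\le 1$ for every vertex $v$; it is perfect if $\sum_{e}\omega(e) = n/k$. Closed walks. A $k$-uniform cycle has a cyclic ordering of its vertices such that its edges are exactly the sets of $k$ cyclically consecutive vertices. A homomorphism is a vertex map sending edges to edges. A closed walk in $G$ is the image of a homomorphism from a $k$-uniform cycle $C$ to $G$; its order is the number of vertices of $C$. Hamilton framework. A family $\mathcal{G}$ of $s$-vertex $k$-graphs has (admits) a Hamilton framework $F$ if for every $G\in\mathcal{G}$ there is an $s$-vertex subgraph $F(G)\subseteq G$ such that (F1) $F(G)$ is a tight component of $G$; (F2) $F(G)$ has a perfect fractional matching; (F3) $F(G)$ contains a closed walk of order $\equiv 1 \bmod k$; (F4) $F(G)\cup F(G')$ is tightly connected whenever $G,G'\in\mathcal{G}$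 are obtained by deleting a distinct vertex from the same $(s+1)$-vertex $k$-graph. (All these notions are applied below to $t$-graphs, i.e. with uniformity $t$ in place of $k$.) Threshold. For a $k$-graph $G$ and $t\ge k$, the clique-graph $K_t(G)$ is the $t$-graph on $V(G)$ whose edges are the $t$-sets $X$ inducing a clique (all $k$-subsets of $X$ are edges of $G$). $\delta_d^{\mathsf{HF}}(k,t)$ is the infimum of all $\delta\in[0,1]$ such that for every $\varepsilon>0$ there is $n_0$ such that, for each $n\ge n_0$, the family of $t$-graphs $K_t(G)$, where $G$ ranges over the $n$-vertex $k$-graphs with $\delta_d(G)\ge(\delta+\varepsilon)\binom{n-d}{k-d}$, admits a Hamilton framework. *)

theory Defs
  imports Complex_Main "HOL-Number_Theory.Cong"
begin

datatype 'a hypergraph = Hypergraph (verts: "'a set") (edges: "'a set set")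

definition kgraph :: "nat \<Rightarrow> 'a hypergraph \<Rightarrow> bool" where
  "kgraph k G \<longleftrightarrow> finite (verts G) \<and> (\<forall>e\<in>edges G. e \<subseteq> verts G \<and> card e = k)"

definition subgraph :: "'a hypergraph \<Rightarrow> 'a hypergraph \<Rightarrow> bool" where
  "subgraph H G \<longleftrightarrow> verts H \<subseteq> verts G \<and> edges H \<subseteq> edges G \<and> (\<forall>e\<in>edges H. e \<subseteq> verts H)"

definition graph_union :: "'a hypergraph \<Rightarrow> 'a hypergraph \<Rightarrow> 'a hypergraph" where
  "graph_union G H = Hypergraph (verts G \<union> verts H) (edges G \<union> edges H)"

definition induced :: "'a hypergraph \<Rightarrow> 'a set \<Rightarrow> 'a hypergraph" where
  "induced G S = Hypergraph (verts G \<inter> S) {e \<in> edges G. e \<subseteq> S}"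

definition delete_vertex :: "'a hypergraph \<Rightarrow> 'a \<Rightarrow> 'a hypergraph" where
  "delete_vertex G v = induced G (verts G - {v})"

text \<open>For \<open>d\<close> larger than the number of vertices the maximum does not exist and the value
  is unspecified. This does not affect the threshold below, which concerns large \<open>n\<close> only.\<close>

definition min_degree :: "nat \<Rightarrow> 'a hypergraph \<Rightarrow> nat" where
  "min_degree d G =
     (GREATEST m. \<forall>S. S \<subseteq> verts G \<and> card S = d \<longrightarrow> m \<le> card {e \<in> edges G. S \<subseteq> e})"

definition line_graph :: "nat \<Rightarrow> 'a hypergraph \<Rightarrow> 'a set hypergraph" where
  "line_graph k G = Hypergraph (edges G)
     {{e, f} | e f. e \<in> edges G \<and> f \<in> edges G \<and> card (e \<inter> f) = k - 1}"

text \<open>Connectedness of 2-graphs; the graph without vertices is not connected.\<close>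

definition connected_2graph :: "'a hypergraph \<Rightarrow> bool" where
  "connected_2graph L \<longleftrightarrow> verts L \<noteq> {} \<and>
     (\<forall>x\<in>verts L. \<forall>y\<in>verts L. (x, y) \<in> {(u, v). {u, v} \<in> edges L}\<^sup>*)"

definition tightly_connected :: "nat \<Rightarrow> 'a hypergraph \<Rightarrow> 'a hypergraph \<Rightarrow> bool" where
  "tightly_connected k G H \<longleftrightarrow> subgraph H G \<and>
     (\<forall>v\<in>verts H. \<exists>e\<in>edges H. v \<in> e) \<and>
     connected_2graph (induced (line_graph k G) (edges H))"

definition tight_component :: "nat \<Rightarrow> 'a hypergraph \<Rightarrow> 'a hypergraph \<Rightarrow> bool" where
  "tight_component k G C \<longleftrightarrow> tightly_connected k G C \<and>
     (\<forall>C'. tightly_connected k G C' \<and> edges C \<subseteq> edges C' \<longrightarrow> edges C' = edges C)"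

definition fractional_matching :: "'a hypergraph \<Rightarrow> ('a set \<Rightarrow> real) \<Rightarrow> bool" where
  "fractional_matching G w \<longleftrightarrow> (\<forall>e\<in>edges G. 0 \<le> w e \<and> w e \<le> 1) \<and>
     (\<forall>v\<in>verts G. (\<Sum>e\<in>{e \<in> edges G. v \<in> e}. w e) \<le> 1)"

definition perfect_fractional_matching :: "nat \<Rightarrow> 'a hypergraph \<Rightarrow> ('a set \<Rightarrow> real) \<Rightarrow> bool" where
  "perfect_fractional_matching k G w \<longleftrightarrow> fractional_matching G w \<and>
     (\<Sum>e\<in>edges G. w e) = real (card (verts G)) / real k"

text \<open>A \<open>k\<close>-uniform cycle has more than \<open>k\<close> vertices. With fewer than \<open>k\<close> there would be no
  \<open>k\<close> consecutive vertices, and a single vertex would count as a cycle of order 1.\<close>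

definition uniform_cycle :: "nat \<Rightarrow> 'a hypergraph \<Rightarrow> bool" where
  "uniform_cycle k C \<longleftrightarrow> (\<exists>vs. distinct vs \<and> k < length vs \<and> verts C = set vs \<and>
     edges C = {{vs ! ((i + j) mod length vs) | j. j < k} | i. i < length vs})"

definition hypergraph_hom :: "('a \<Rightarrow> 'b) \<Rightarrow> 'a hypergraph \<Rightarrow> 'b hypergraph \<Rightarrow> bool" where
  "hypergraph_hom h C G \<longleftrightarrow> h ` verts C \<subseteq> verts G \<and> (\<forall>e\<in>edges C. h ` e \<in> edges G)"

text \<open>\<open>W\<close> is a closed walk of order \<open>m\<close> in \<open>G\<close>. The cycle may live on any vertex set;
  natural numbers suffice up to isomorphism.\<close>

definition closed_walk :: "nat \<Rightarrow> 'a hypergraph \<Rightarrow> 'a hypergraph \<Rightarrow> nat \<Rightarrow> bool" where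
  "closed_walk k G W m \<longleftrightarrow> (\<exists>(C :: nat hypergraph) h.
     uniform_cycle k C \<and> card (verts C) = m \<and> hypergraph_hom h C G \<and>
     W = Hypergraph (h ` verts C) ((`) h ` edges C))"

definition hamilton_framework ::
  "nat \<Rightarrow> nat \<Rightarrow> 'a hypergraph set \<Rightarrow> ('a hypergraph \<Rightarrow> 'a hypergraph) \<Rightarrow> bool" where
  "hamilton_framework k s \<G> F \<longleftrightarrow>
     (\<forall>G\<in>\<G>. kgraph k G \<and> card (verts G) = s) \<and>
     (\<forall>G\<in>\<G>. subgraph (F G) G \<and> card (verts (F G)) = s) \<and>
     (\<forall>G\<in>\<G>. tight_component k G (F G)) \<and>
     (\<forall>G\<in>\<G>. \<exists>w. perfect_fractional_matching k (F G) w) \<and>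
     (\<forall>G\<in>\<G>. \<exists>W m. closed_walk k (F G) W m \<and> [m = 1] (mod k)) \<and>
     (\<forall>G\<in>\<G>. \<forall>G'\<in>\<G>. \<forall>H v v'.
        kgraph k H \<and> card (verts H) = s + 1 \<and> v \<in> verts H \<and> v' \<in> verts H \<and> v \<noteq> v' \<and>
        G = delete_vertex H v \<and> G' = delete_vertex H v' \<longrightarrow>
        tightly_connected k H (graph_union (F G) (F G')))"

definition clique_graph :: "nat \<Rightarrow> nat \<Rightarrow> 'a hypergraph \<Rightarrow> 'a hypergraph" where
  "clique_graph k t G = Hypergraph (verts G)
     {X. X \<subseteq> verts G \<and> card X = t \<and> (\<forall>Y. Y \<subseteq> X \<and> card Y = k \<longrightarrow> Y \<in> edges G)}"

text \<open>All finite graphs are taken with vertices in the natural numbers, which covers every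
  finite graph up to isomorphism.\<close>

definition clique_graph_family :: "nat \<Rightarrow> nat \<Rightarrow> nat \<Rightarrow> real \<Rightarrow> nat \<Rightarrow> nat hypergraph set" where
  "clique_graph_family d k t \<gamma> n = {clique_graph k t G | G. kgraph k G \<and> card (verts G) = n \<and>
     real (min_degree d G) \<ge> \<gamma> * real ((n - d) choose (k - d))}"

definition HF_threshold :: "nat \<Rightarrow> nat \<Rightarrow> nat \<Rightarrow> real" where
  "HF_threshold d k t = Inf {\<delta>. 0 \<le> \<delta> \<and> \<delta> \<le> 1 \<and>
     (\<forall>\<epsilon>>0. \<exists>n0. \<forall>n\<ge>n0. \<exists>F. hamilton_framework t n (clique_graph_family d k t (\<delta> + \<epsilon>) n) F)}"

definition f_bound :: "nat \<Rightarrow> nat \<Rightarrow> real" where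
  "f_bound k t = 1 - 1 / (real ((t - 1) choose (k - 1)) + real ((t - 2) choose (k - 2)))"

end

theory Submission
  imports Defs "HOL-Analysis.Analysis"
begin

text \<open>
  Write \<open>D = ((t - 1) choose (k - 1)) + ((t - 2) choose (k - 2))\<close>, so that the bound is
  \<open>1 - 1 / D\<close>. If \<open>n\<close> is large and every \<open>(k - 1)\<close>-set of the \<open>k\<close>-graph \<open>G\<close> has codegree at
  least \<open>(1 - 1 / D + \<epsilon>) (n - k + 1)\<close>, then fewer than \<open>n / D\<close> vertices fail to extend a given
  \<open>(k - 1)\<close>-set to an edge. The number \<open>D\<close> is exactly the number of \<open>(k - 1)\<close>-sets that lie
  inside one of two \<open>(t - 1)\<close>-sets sharing \<open>t - 2\<close> elements. Hence two such cliques \<open>S\<close>, \<open>S'\<close> always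
  have a common neighbour \<open>w\<close>, for which \<open>insert w S\<close> and \<open>insert w S'\<close> are both cliques
  (\<open>extend_clique_pair\<close>). This makes the whole clique graph a valid choice of \<open>F\<close>.

  Connectivity. The \<open>j\<close>-cliques are tightly linked for \<open>1 \<le> j \<le> t\<close>, by induction on \<open>j\<close>: a chain
  of \<open>j\<close>-cliques lifts to a chain of \<open>(j + 1)\<close>-cliques, because consecutive members have a common
  neighbour. Two clique graphs that arise by deleting different vertices from one graph share every
  clique of the first that avoids the second vertex, so their union is tightly linked too.

  Closed walk. In any \<open>t\<close>-clique \<open>X\<close>, the sets \<open>X - {a}\<close> and \<open>X - {b}\<close> have a common neighbour. Going
  around \<open>X\<close> and replacing one vertex per round, one can therefore exchange the positions of \<open>a\<close> and
  \<open>b\<close> in a number of steps divisible by \<open>t\<close>. One extra step rotates the tuple cyclically, and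
  exchanges undo that rotation, which gives a closed walk of order \<open>1\<close> modulo \<open>t\<close>.

  Perfect fractional matching. Among the weightings of the cliques with the right total, one
  minimises the sum of the squared deviations of the vertex degrees from \<open>1\<close>. If the deviations
  \<open>y\<close> are not all zero, shifting weight towards a clique \<open>X\<close> with \<open>n y(X) \<le> t y(V)\<close> decreases that
  sum. Such a light clique exists for every \<open>y\<close> (\<open>ex_light_clique\<close>): order the vertices by \<open>y\<close> and
  choose the clique greedily; its \<open>i\<close>-th vertex, counted from \<open>0\<close>, can be taken among the
  positions up to \<open>i n / t\<close>, since \<open>(i choose (k - 1)) / D \<le> i / t\<close>.
\<close>

section \<open>Counting subsets\<close>

text \<open>The number of \<open>(k - 1)\<close>-subsets of two \<open>(t - 1)\<close>-sets that have \<open>t - 2\<close> common elements.\<close>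

definition pair_subset_count :: "nat \<Rightarrow> nat \<Rightarrow> nat" where
  "pair_subset_count k t = ((t - 1) choose (k - 1)) + ((t - 2) choose (k - 2))"

lemma f_bound_eq: "f_bound k t = 1 - 1 / real (pair_subset_count k t)"
  by (simp add: f_bound_def pair_subset_count_def)

lemma pair_subset_count_ge_2:
  assumes "2 \<le> k" "k \<le> t"
  shows "2 \<le> pair_subset_count k t"
proof -
  have "0 < (t - 1) choose (k - 1)" "0 < (t - 2) choose (k - 2)"
    using assms by (simp_all add: zero_less_binomial_iff)
  then show ?thesis unfolding pair_subset_count_def by linarith
qed

text \<open>This governs the greedy choice of a light clique: when \<open>i\<close> vertices are chosen, each of the
  \<open>i choose (k - 1)\<close> sets forbids at most \<open>n / D\<close> vertices, altogether at most \<open>i n / t\<close>.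
  It follows from absorption, \<open>(k - 1) (i choose (k - 1)) = i ((i - 1) choose (k - 2))\<close>, used for \<open>i\<close>
  and for \<open>t - 1\<close>.\<close>

lemma subset_count_le:
  assumes "2 \<le> k" "k \<le> t" "i < t"
  shows "t * (i choose (k - 1)) \<le> i * pair_subset_count k t"
proof (cases i)
  case 0
  then show ?thesis using assms by (simp add: binomial_eq_0)
next
  case (Suc j)
  obtain l m where l: "k = Suc (Suc l)" and m: "t = Suc (Suc m)"
  proof
    show "k = Suc (Suc (k - 2))" "t = Suc (Suc (t - 2))" using assms by auto
  qed
  have a: "Suc l * (Suc j choose Suc l) = Suc j * (j choose l)"
    by (rule Suc_times_binomial)
  have b: "Suc l * (Suc m choose Suc l) = Suc m * (m choose l)"
    by (rule Suc_times_binomial)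
  have jm: "(j choose l) \<le> (m choose l)" using Suc assms(3) m by (intro binomial_right_mono) simp
  have "Suc l * (t * (i choose (k - 1))) = t * (Suc j * (j choose l))"
    using a unfolding Suc l by (simp only: diff_Suc_1 mult.left_commute[of "Suc l" t])
  also have "\<dots> \<le> t * (Suc j * (m choose l))" using jm by (intro mult_le_mono le_refl)
  also have "\<dots> = Suc j * ((Suc m + 1) * (m choose l))"
    unfolding m by (simp only: Suc_eq_plus1 mult.left_commute)
  also have "\<dots> \<le> Suc j * ((Suc m + Suc l) * (m choose l))"
    by (intro mult_le_mono) auto
  also have "\<dots> = Suc j * (Suc l * (Suc m choose Suc l) + Suc l * (m choose l))"
    unfolding b by (simp only: add_mult_distrib)
  also have "\<dots> = Suc l * (i * pair_subset_count k t)"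
    unfolding pair_subset_count_def l m Suc by (simp add: algebra_simps)
  finally show ?thesis using Suc_mult_le_cancel1 by blast
qed

lemma card_common_subsets_le:
  assumes "2 \<le> k" "k \<le> t" "1 \<le> j" "j < t"
    and "finite S" "finite S'" "card S = j" "card S' = j" "card (S \<inter> S') = j - 1"
  shows "card ({A. A \<subseteq> S \<and> card A = k - 1} \<union> {A. A \<subseteq> S' \<and> card A = k - 1}) \<le> pair_subset_count k t"
proof -
  let ?P = "\<lambda>X. {A. A \<subseteq> X \<and> card A = k - 1}"
  have fin: "finite (?P X)" if "finite X" for X :: "'a set"
    using that by (rule_tac finite_subset[of _ "Pow X"]) auto
  have c: "card (?P X) = (card X choose (k - 1))" if "finite X" for X :: "'a set"
    using n_subsets[OF that] by simp
  have "?P S \<inter> ?P S' = ?P (S \<inter> S')" by auto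
  then have "card (?P S \<inter> ?P S') = ((j - 1) choose (k - 1))"
    using c[of "S \<inter> S'"] assms(5,9) by (metis finite_Int)
  moreover have "card (?P S) = (j choose (k - 1))" "card (?P S') = (j choose (k - 1))"
    using c assms(5-8) by simp_all
  ultimately have "card (?P S \<union> ?P S') + ((j - 1) choose (k - 1)) = 2 * (j choose (k - 1))"
    using card_Un_Int[OF fin[OF assms(5)] fin[OF assms(6)]] by linarith
  moreover have "(j choose (k - 1)) = ((j - 1) choose (k - 1)) + ((j - 1) choose (k - 2))"
  proof -
    have "Suc (j - 1) = j" "Suc (k - 2) = k - 1" using assms by auto
    then show ?thesis using binomial_Suc_Suc[of "j - 1" "k - 2"] by (simp only: add.commute)
  qed
  ultimately have "card (?P S \<union> ?P S') = (j choose (k - 1)) + ((j - 1) choose (k - 2))"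
    by linarith
  also have "\<dots> \<le> pair_subset_count k t"
    unfolding pair_subset_count_def using assms
    by (intro add_mono binomial_right_mono) auto
  finally show ?thesis .
qed

section \<open>Extending cliques\<close>

definition clique :: "nat \<Rightarrow> 'a hypergraph \<Rightarrow> 'a set \<Rightarrow> bool" where
  "clique k G X \<longleftrightarrow> X \<subseteq> verts G \<and> (\<forall>Y. Y \<subseteq> X \<and> card Y = k \<longrightarrow> Y \<in> edges G)"

lemma edges_clique_graph: "X \<in> edges (clique_graph k t G) \<longleftrightarrow> clique k G X \<and> card X = t"
  by (auto simp: clique_graph_def clique_def)

lemma verts_clique_graph [simp]: "verts (clique_graph k t G) = verts G"
  by (simp add: clique_graph_def)

lemma clique_subset: "clique k G X \<Longrightarrow> Y \<subseteq> X \<Longrightarrow> clique k G Y"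
  by (auto simp: clique_def)

lemma clique_insert:
  assumes "clique k G X" "finite X" "w \<in> verts G" "w \<notin> X" "0 < k"
    and "\<And>S. S \<subseteq> X \<Longrightarrow> card S = k - 1 \<Longrightarrow> insert w S \<in> edges G"
  shows "clique k G (insert w X)"
  unfolding clique_def
proof (intro conjI allI impI)
  show "insert w X \<subseteq> verts G" using assms by (auto simp: clique_def)
  fix Y assume Y: "Y \<subseteq> insert w X \<and> card Y = k"
  show "Y \<in> edges G"
  proof (cases "w \<in> Y")
    case True
    have "finite Y" using Y assms(2) by (meson finite.insertI finite_subset)
    then have "card (Y - {w}) = k - 1" using Y True by (simp add: card_Diff_singleton)
    moreover have "Y - {w} \<subseteq> X" using Y by auto
    ultimately have "insert w (Y - {w}) \<in> edges G" using assms(6) by blast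
    then show ?thesis using True by (simp add: insert_absorb)
  next
    case False
    then have "Y \<subseteq> X" using Y by auto
    then show ?thesis using Y assms(1) by (auto simp: clique_def)
  qed
qed

text \<open>An exact, integral form of the codegree condition. The summand \<open>t\<close> next to \<open>b\<close> is slack
  for the vertices that a construction has already used.\<close>

locale dense_kgraph =
  fixes k t b :: nat and G :: "'a hypergraph"
  assumes k_ge_2: "2 \<le> k" and k_le_t: "k \<le> t"
    and kgraph: "kgraph k G"
    and non_neighbours:
      "\<And>S. S \<subseteq> verts G \<Longrightarrow> card S = k - 1 \<Longrightarrow>
        card {w \<in> verts G - S. insert w S \<notin> edges G} \<le> b"
    and many_vertices: "pair_subset_count k t * (b + t) \<le> card (verts G)"
begin

lemma finite_verts [simp]: "finite (verts G)"
  using kgraph by (simp add: kgraph_def)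

lemma finite_clique: "clique k G X \<Longrightarrow> finite X"
  by (meson clique_def finite_subset finite_verts)

text \<open>A union bound over \<open>\<S>\<close>; the set \<open>X\<close> collects the vertices that must not be chosen.\<close>

lemma common_neighbour:
  assumes I: "I \<subseteq> verts G" and X: "finite X"
    and \<S>: "finite \<S>" "\<And>S. S \<in> \<S> \<Longrightarrow> S \<subseteq> X \<inter> verts G \<and> card S = k - 1"
    and large: "card \<S> * b + card X < card I"
  shows "\<exists>w\<in>I - X. \<forall>S\<in>\<S>. insert w S \<in> edges G"
proof (rule ccontr)
  assume contra: "\<not> ?thesis"
  let ?bad = "\<lambda>S. {w \<in> verts G - S. insert w S \<notin> edges G}"
  have "I \<subseteq> X \<union> (\<Union>S\<in>\<S>. ?bad S)"
  proof
    fix w assume w: "w \<in> I"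
    show "w \<in> X \<union> (\<Union>S\<in>\<S>. ?bad S)"
    proof (cases "w \<in> X")
      case False
      then obtain S where "S \<in> \<S>" "insert w S \<notin> edges G" using contra w by auto
      moreover from this have "w \<in> ?bad S" using False w I \<S>(2)[of S] by auto
      ultimately show ?thesis by blast
    qed simp
  qed
  moreover have "finite (X \<union> (\<Union>S\<in>\<S>. ?bad S))" using X \<S>(1) by auto
  ultimately have "card I \<le> card (X \<union> (\<Union>S\<in>\<S>. ?bad S))" by (rule card_mono[rotated])
  also have "\<dots> \<le> card X + card (\<Union>S\<in>\<S>. ?bad S)" by (rule card_Un_le)
  also have "card (\<Union>S\<in>\<S>. ?bad S) \<le> (\<Sum>S\<in>\<S>. card (?bad S))"
    using \<S>(1) by (rule card_UN_le)
  also have "\<dots> \<le> card \<S> * b"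
    using sum_bounded_above[of \<S> "\<lambda>S. card (?bad S)" b] non_neighbours \<S>(2) by simp
  finally show False using large by simp
qed

lemma extend_clique:
  assumes "clique k G X" "finite Z" "I \<subseteq> verts G"
    and "(card X choose (k - 1)) * b + card (X \<union> Z) < card I"
  shows "\<exists>w\<in>I - X - Z. clique k G (insert w X)"
proof -
  let ?S = "{S. S \<subseteq> X \<and> card S = k - 1}"
  have fX: "finite X" using assms(1) by (rule finite_clique)
  have cS: "card ?S = (card X choose (k - 1))" using n_subsets[OF fX] by simp
  have finS: "finite ?S" using fX by (rule_tac finite_subset[of _ "Pow X"]) auto
  have "A \<subseteq> (X \<union> Z) \<inter> verts G \<and> card A = k - 1" if "A \<in> ?S" for A
    using that assms(1) by (auto simp: clique_def)
  then obtain w where "w \<in> I - (X \<union> Z)" "\<forall>S\<in>?S. insert w S \<in> edges G"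
    using common_neighbour[OF assms(3) finite_UnI[OF fX assms(2)] finS] assms(4) unfolding cS by blast
  moreover from this have "clique k G (insert w X)"
    by (intro clique_insert[OF assms(1) fX]) (use assms(3) k_ge_2 in auto)
  ultimately show ?thesis by blast
qed

text \<open>The step on which everything rests: only the \<open>(k - 1)\<close>-subsets of \<open>S\<close> or of \<open>S'\<close> matter, and
  there are at most \<open>D\<close> of them.\<close>

lemma extend_clique_pair:
  assumes "clique k G S" "clique k G S'" "card S = j" "card S' = j" "card (S \<inter> S') = j - 1"
    and "1 \<le> j" "j < t"
  shows "\<exists>w. w \<notin> S \<union> S' \<and> clique k G (insert w S) \<and> clique k G (insert w S')"
proof -
  let ?P = "{A. A \<subseteq> S \<and> card A = k - 1} \<union> {A. A \<subseteq> S' \<and> card A = k - 1}"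
  let ?D = "pair_subset_count k t"
  have fin: "finite S" "finite S'" using assms finite_clique by auto
  have sub: "S \<subseteq> verts G" "S' \<subseteq> verts G" using assms by (auto simp: clique_def)
  have finP: "finite ?P" using fin
    by (rule_tac finite_subset[of _ "Pow S \<union> Pow S'"]) auto
  have "card ?P \<le> ?D"
    using card_common_subsets_le[OF k_ge_2 k_le_t assms(6,7) fin assms(3-5)] .
  then have "card ?P * b \<le> ?D * b" by simp
  moreover have "card (S \<union> S') < ?D * t"
  proof -
    have "card (S \<union> S') = j + 1" using card_Un_Int[OF fin] assms by simp
    moreover have "2 * t \<le> ?D * t" using pair_subset_count_ge_2[OF k_ge_2 k_le_t] by simp
    ultimately show ?thesis using assms(6,7) by linarith
  qed
  ultimately have "card ?P * b + card (S \<union> S') < card (verts G)"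
    using many_vertices add_mult_distrib2[of ?D b t] by linarith
  moreover have "A \<subseteq> (S \<union> S') \<inter> verts G \<and> card A = k - 1" if "A \<in> ?P" for A
    using that sub by blast
  ultimately obtain w where w: "w \<in> verts G - (S \<union> S')" "\<forall>A\<in>?P. insert w A \<in> edges G"
    using common_neighbour[OF subset_refl finite_UnI[OF fin] finP] by blast
  show ?thesis
  proof (intro exI conjI)
    show "w \<notin> S \<union> S'" using w(1) by simp
    show "clique k G (insert w S)"
      by (rule clique_insert[OF assms(1) fin(1)]) (use w k_ge_2 in auto)
    show "clique k G (insert w S')"
      by (rule clique_insert[OF assms(2) fin(2)]) (use w k_ge_2 in auto)
  qed
qed

text \<open>Greedy extension of \<open>{v}\<close>. The set \<open>Z\<close> will be empty or consist of a single deleted vertex.\<close>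

lemma clique_through_vertex:
  assumes "v \<in> verts G" "v \<notin> Z" "finite Z" "card Z \<le> 1" "j < t"
  shows "\<exists>X. clique k G X \<and> card X = Suc j \<and> v \<in> X \<and> X \<inter> Z = {}"
  using assms(5)
proof (induction j)
  case 0
  have "clique k G {v}"
    using assms(1) k_ge_2 by (auto simp: clique_def subset_singleton_iff)
  then show ?case using assms(2) by (intro exI[of _ "{v}"]) auto
next
  case (Suc j)
  from Suc.IH[OF Suc_lessD[OF Suc.prems]]
  obtain X where X: "clique k G X" "card X = Suc j" "v \<in> X" "X \<inter> Z = {}"
    by (elim exE conjE) (rule that)
  let ?D = "pair_subset_count k t"
  have "(card X choose (k - 1)) \<le> ((t - 1) choose (k - 1))"
    using Suc.prems X(2) by (intro binomial_right_mono) simp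
  then have "(card X choose (k - 1)) * b \<le> ?D * b"
    by (intro mult_le_mono1) (simp add: pair_subset_count_def)
  moreover have "card (X \<union> Z) < ?D * t"
  proof -
    have "card (X \<union> Z) \<le> Suc j + 1" using card_Un_le[of X Z] X assms(4) by simp
    moreover have "2 * t \<le> ?D * t" using pair_subset_count_ge_2[OF k_ge_2 k_le_t] by simp
    ultimately show ?thesis using Suc.prems by linarith
  qed
  ultimately have "(card X choose (k - 1)) * b + card (X \<union> Z) < card (verts G)"
    using many_vertices add_mult_distrib2[of ?D b t] by linarith
  from extend_clique[OF X(1) assms(3) subset_refl this]
  obtain w where w: "w \<in> verts G - X - Z" "clique k G (insert w X)" by blast
  then have "card (insert w X) = Suc (Suc j)" using X finite_clique[OF X(1)] by simp
  then show ?case using X w by blast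
qed

end

section \<open>Tight connectivity\<close>

definition tight_adj :: "nat \<Rightarrow> 'a set set \<Rightarrow> ('a set \<times> 'a set) set" where
  "tight_adj t E = {(e, f). e \<in> E \<and> f \<in> E \<and> card (e \<inter> f) = t - 1}"

definition tightly_linked :: "nat \<Rightarrow> 'a set set \<Rightarrow> bool" where
  "tightly_linked t E \<longleftrightarrow> (\<forall>e\<in>E. \<forall>f\<in>E. (e, f) \<in> (tight_adj t E)\<^sup>*)"

lemma connected_line_graph_iff:
  assumes "E \<subseteq> edges H"
  shows "connected_2graph (induced (line_graph t H) E) \<longleftrightarrow> E \<noteq> {} \<and> tightly_linked t E"
proof -
  let ?L = "induced (line_graph t H) E"
  have v: "verts ?L = E" using assms by (auto simp: induced_def line_graph_def)
  have "{u, v} \<in> edges ?L \<longleftrightarrow> (u, v) \<in> tight_adj t E" for u v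
    using assms by (auto simp: induced_def line_graph_def tight_adj_def doubleton_eq_iff Int_commute)
  then have "{(u, v). {u, v} \<in> edges ?L} = tight_adj t E" by auto
  then show ?thesis unfolding connected_2graph_def tightly_linked_def v by simp
qed

lemma tightly_linked_Un:
  assumes "tightly_linked t E" "tightly_linked t E'" "e \<in> E \<inter> E'"
  shows "tightly_linked t (E \<union> E')"
proof -
  have sub: "(tight_adj t E)\<^sup>* \<subseteq> (tight_adj t (E \<union> E'))\<^sup>*" "(tight_adj t E')\<^sup>* \<subseteq> (tight_adj t (E \<union> E'))\<^sup>*"
    by (intro rtrancl_mono; auto simp: tight_adj_def)+
  have to: "(x, e) \<in> (tight_adj t (E \<union> E'))\<^sup>*" and from_e: "(e, x) \<in> (tight_adj t (E \<union> E'))\<^sup>*"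
    if "x \<in> E \<union> E'" for x
    using that assms sub unfolding tightly_linked_def by blast+
  show ?thesis unfolding tightly_linked_def
    using to from_e rtrancl_trans by metis
qed

context dense_kgraph
begin

abbreviation cliques :: "nat \<Rightarrow> 'a set set" where
  "cliques j \<equiv> edges (clique_graph k j G)"

text \<open>Each \<open>(j + 1)\<close>-clique contains a \<open>j\<close>-clique, and two \<open>(j + 1)\<close>-cliques over the same
  \<open>j\<close>-clique are equal or adjacent. So it suffices to lift a single adjacency \<open>S'\<close>, \<open>S''\<close> of
  \<open>j\<close>-cliques, and a common neighbour \<open>w\<close> lifts it to \<open>insert w S'\<close>, \<open>insert w S''\<close>.\<close>

lemma tightly_linked_cliques_step:
  assumes "1 \<le> j" "j < t" "tightly_linked j (cliques j)"
  shows "tightly_linked (Suc j) (cliques (Suc j))"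
proof -
  let ?R = "(tight_adj (Suc j) (cliques (Suc j)))\<^sup>*"
  have common: "(X, Y) \<in> ?R"
    if "X \<in> cliques (Suc j)" "Y \<in> cliques (Suc j)" "S \<subseteq> X" "S \<subseteq> Y" "card S = j" for X Y S
  proof (cases "X = Y")
    case False
    have fin: "finite X" "finite Y" and card: "card X = Suc j" "card Y = Suc j"
      using that finite_clique by (auto simp: edges_clique_graph)
    have "S \<subseteq> X \<inter> Y" using that by blast
    then have "j \<le> card (X \<inter> Y)" using that(5) card_mono[of "X \<inter> Y" S] fin by simp
    moreover have "card (X \<inter> Y) \<noteq> Suc j"
    proof
      assume c: "card (X \<inter> Y) = Suc j"
      have "X \<inter> Y = X" using card_subset_eq[OF fin(1) Int_lower1] c card by simp
      moreover have "X \<inter> Y = Y" using card_subset_eq[OF fin(2) Int_lower2] c card by simp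
      ultimately show False using False by simp
    qed
    moreover have "card (X \<inter> Y) \<le> Suc j" using card card_mono[OF fin(1) Int_lower1, of Y] by simp
    ultimately have "(X, Y) \<in> tight_adj (Suc j) (cliques (Suc j))"
      using that by (simp add: tight_adj_def)
    then show ?thesis by (rule r_into_rtrancl)
  qed simp
  have lift: "\<forall>X\<in>cliques (Suc j). \<forall>Y\<in>cliques (Suc j). S \<subseteq> X \<longrightarrow> S' \<subseteq> Y \<longrightarrow> (X, Y) \<in> ?R"
    if "(S, S') \<in> (tight_adj j (cliques j))\<^sup>*" "S \<in> cliques j" for S S'
    using that
  proof (induction rule: rtrancl_induct)
    case base
    then show ?case using common by (auto simp: edges_clique_graph)
  next
    case (step S' S'')
    have S': "clique k G S'" "card S' = j" and S'': "clique k G S''" "card S'' = j"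
      and cap: "card (S' \<inter> S'') = j - 1"
      using step.hyps(2) by (auto simp: tight_adj_def edges_clique_graph)
    obtain w where w: "w \<notin> S' \<union> S''" "clique k G (insert w S')" "clique k G (insert w S'')"
      using extend_clique_pair[OF S'(1) S''(1) S'(2) S''(2) cap assms(1,2)] by blast
    have fin: "finite S'" "finite S''" using S' S'' finite_clique by auto
    have e: "insert w S' \<in> cliques (Suc j)" "insert w S'' \<in> cliques (Suc j)"
      using w S' S'' fin by (auto simp: edges_clique_graph)
    have "insert w S' \<inter> insert w S'' = insert w (S' \<inter> S'')" by blast
    then have "card (insert w S' \<inter> insert w S'') = j" using w cap fin assms(1) by simp
    then have adj: "(insert w S', insert w S'') \<in> ?R"
      using e by (intro r_into_rtrancl) (simp add: tight_adj_def)
    show ?case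
    proof (intro ballI impI)
      fix X Y assume XY: "X \<in> cliques (Suc j)" "Y \<in> cliques (Suc j)" "S \<subseteq> X" "S'' \<subseteq> Y"
      have "(X, insert w S') \<in> ?R" using step.IH[OF step.prems] XY(1,3) e(1) by blast
      also note adj
      also have "(insert w S'', Y) \<in> ?R"
        using common[OF e(2) XY(2) subset_insertI XY(4) S''(2)] .
      finally show "(X, Y) \<in> ?R" .
    qed
  qed
  show ?thesis unfolding tightly_linked_def
  proof (intro ballI)
    fix X Y assume XY: "X \<in> cliques (Suc j)" "Y \<in> cliques (Suc j)"
    have ex: "\<exists>S. S \<subseteq> X \<and> S \<in> cliques j" if "X \<in> cliques (Suc j)" for X
    proof -
      have X: "clique k G X" "card X = Suc j" using that by (auto simp: edges_clique_graph)
      then obtain S where "S \<subseteq> X" "card S = j"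
        using obtain_subset_with_card_n[of j X] by auto
      then show ?thesis using clique_subset[OF X(1)] by (auto simp: edges_clique_graph)
    qed
    obtain S S' where S: "S \<subseteq> X" "S \<in> cliques j" "S' \<subseteq> Y" "S' \<in> cliques j"
      using ex[OF XY(1)] ex[OF XY(2)] by blast
    have "(S, S') \<in> (tight_adj j (cliques j))\<^sup>*"
      using assms(3) S(2,4) by (simp add: tightly_linked_def)
    from lift[OF this S(2)] show "(X, Y) \<in> ?R" using XY S(1,3) by blast
  qed
qed

lemma tightly_linked_cliques:
  assumes "j < t"
  shows "tightly_linked (Suc j) (cliques (Suc j))"
  using assms
proof (induction j)
  case 0
  \<comment> \<open>Distinct singletons are disjoint, and uniformity \<open>1\<close> asks for intersections of size \<open>0\<close>.\<close>
  show ?case unfolding tightly_linked_def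
  proof (intro ballI)
    fix X Y assume "X \<in> cliques (Suc 0)" "Y \<in> cliques (Suc 0)"
    then show "(X, Y) \<in> (tight_adj (Suc 0) (cliques (Suc 0)))\<^sup>*"
    proof (cases "X = Y")
      case False
      then have "X \<inter> Y = {}" using \<open>X \<in> _\<close> \<open>Y \<in> _\<close>
        by (auto simp: edges_clique_graph card_1_singleton_iff)
      then show ?thesis using \<open>X \<in> _\<close> \<open>Y \<in> _\<close>
        by (intro r_into_rtrancl) (simp add: tight_adj_def)
    qed simp
  qed
next
  case (Suc j)
  show ?case
    by (rule tightly_linked_cliques_step) (use Suc in auto)
qed

lemma t_pos: "0 < t"
  using k_ge_2 k_le_t by simp

lemma ex_clique_avoiding:
  assumes "v \<in> verts G" "v \<notin> Z" "finite Z" "card Z \<le> 1"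
  shows "\<exists>X\<in>cliques t. v \<in> X \<and> X \<inter> Z = {}"
  using clique_through_vertex[OF assms, of "t - 1"] t_pos by (auto simp: edges_clique_graph)

lemma two_le_card_verts: "2 \<le> card (verts G)"
proof -
  have "2 * 1 \<le> pair_subset_count k t * (b + t)"
    using pair_subset_count_ge_2[OF k_ge_2 k_le_t] t_pos by (intro mult_le_mono) auto
  then show ?thesis using many_vertices by linarith
qed

lemma clique_graph_kgraph: "kgraph t (clique_graph k t G)"
  by (auto simp: kgraph_def edges_clique_graph clique_def)

lemma tightly_linked_clique_graph: "tightly_linked t (cliques t)"
  using tightly_linked_cliques[of "t - 1"] t_pos by simp

lemma cliques_cover: "v \<in> verts G \<Longrightarrow> \<exists>X\<in>cliques t. v \<in> X"
  using ex_clique_avoiding[of v "{}"] by auto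

lemma cliques_nonempty: "cliques t \<noteq> {}"
  using cliques_cover two_le_card_verts by fastforce

lemma clique_graph_tight_component: "tight_component t (clique_graph k t G) (clique_graph k t G)"
proof -
  have "subgraph (clique_graph k t G) (clique_graph k t G)"
    by (auto simp: subgraph_def edges_clique_graph clique_def)
  then have "tightly_connected t (clique_graph k t G) (clique_graph k t G)"
    using connected_line_graph_iff[OF subset_refl] cliques_nonempty tightly_linked_clique_graph
      cliques_cover by (auto simp: tightly_connected_def)
  then show ?thesis by (auto simp: tight_component_def tightly_connected_def subgraph_def)
qed

end

text \<open>A clique of \<open>G\<close> that avoids \<open>v'\<close> is an edge of \<open>H\<close> avoiding both deleted vertices, hence
  also a clique of \<open>G'\<close>. The two tightly linked families therefore overlap.\<close>

lemma tightly_connected_union_delete_vertex: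
  fixes G G' :: "'a hypergraph"
  assumes "dense_kgraph k t b G" "dense_kgraph k t b' G'" "v \<noteq> v'"
    and del: "clique_graph k t G = delete_vertex H v" "clique_graph k t G' = delete_vertex H v'"
  shows "tightly_connected t H (graph_union (clique_graph k t G) (clique_graph k t G'))"
proof -
  interpret G: dense_kgraph k t b G by fact
  interpret G': dense_kgraph k t b' G' by fact
  have verts: "verts G = verts H - {v}" "verts G' = verts H - {v'}"
    using arg_cong[OF del(1), of verts] arg_cong[OF del(2), of verts]
    by (auto simp: delete_vertex_def induced_def)
  have edges: "G.cliques t = {e \<in> edges H. e \<subseteq> verts H - {v}}"
    "G'.cliques t = {e \<in> edges H. e \<subseteq> verts H - {v'}}"
    using arg_cong[OF del(1), of edges] arg_cong[OF del(2), of edges]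
    by (auto simp: delete_vertex_def induced_def)
  let ?E = "G.cliques t \<union> G'.cliques t"
  obtain u where "u \<in> verts G" "u \<noteq> v'"
  proof -
    have "\<not> verts G \<subseteq> {v'}"
      using G.two_le_card_verts card_mono[of "{v'}" "verts G"] by auto
    then show ?thesis using that by auto
  qed
  then obtain X where "X \<in> G.cliques t" "X \<inter> {v'} = {}"
    using G.ex_clique_avoiding[of u "{v'}"] by auto
  then have "X \<in> G.cliques t \<inter> G'.cliques t" unfolding edges by auto
  then have "tightly_linked t ?E"
    by (rule tightly_linked_Un[OF G.tightly_linked_clique_graph G'.tightly_linked_clique_graph])
  moreover have "?E \<subseteq> edges H" unfolding edges by auto
  ultimately have "connected_2graph (induced (line_graph t H) ?E)"
    using connected_line_graph_iff G.cliques_nonempty by blast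
  moreover have "subgraph (graph_union (clique_graph k t G) (clique_graph k t G')) H"
    unfolding subgraph_def graph_union_def hypergraph.sel verts_clique_graph
    unfolding edges verts by auto
  moreover have "\<exists>e\<in>?E. x \<in> e" if "x \<in> verts G \<union> verts G'" for x
    using that G.cliques_cover G'.cliques_cover by blast
  ultimately show ?thesis by (simp add: tightly_connected_def graph_union_def)
qed

section \<open>Closed walks\<close>

text \<open>A walk is seen through its window of \<open>t\<close> consecutive vertices: a step drops the first
  vertex and appends a new one. A loop of \<open>m > t\<close> steps gives a homomorphism from the cycle on \<open>m\<close>
  vertices.\<close>

definition walk_step :: "nat \<Rightarrow> 'a set set \<Rightarrow> ('a list \<times> 'a list) set" where
  "walk_step t E = {(xs, tl xs @ [c]) | xs c.
     length xs = t \<and> set xs \<in> E \<and> set (tl xs @ [c]) \<in> E}"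

lemma closed_walk_of_walk_steps:
  fixes K :: "'a hypergraph"
  assumes loop: "(xs, xs) \<in> walk_step t (edges K) ^^ m"
    and t: "0 < t" "t < m" and sub: "\<And>e. e \<in> edges K \<Longrightarrow> e \<subseteq> verts K"
  shows "\<exists>W. closed_walk t K W m"
proof -
  obtain f where f: "f 0 = xs" "f m = xs" "\<And>i. i < m \<Longrightarrow> (f i, f (Suc i)) \<in> walk_step t (edges K)"
    using loop unfolding relpow_fun_conv by blast
  define g where "g i = f (i mod m)" for i
  have m: "0 < m" using t by simp
  have step: "(g i, g (Suc i)) \<in> walk_step t (edges K)" for i
  proof -
    have "g (Suc i) = f (Suc (i mod m))"
      unfolding g_def mod_Suc using f(1,2) by auto
    then show ?thesis using f(3)[of "i mod m"] m by (simp add: g_def)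
  qed
  have len: "length (g i) = t" and edge: "set (g i) \<in> edges K" for i
    using step[of i] by (auto simp: walk_step_def)
  \<comment> \<open>The whole window at time \<open>i\<close> is read off from the first entries of later windows.\<close>
  have nth: "g i ! j = hd (g (i + j))" if "j < t" for i j
    using that
  proof (induction j arbitrary: i)
    case 0
    have "g i \<noteq> []" using len[of i] t(1) by auto
    then show ?case by (simp add: hd_conv_nth)
  next
    case (Suc j)
    obtain c where c: "g (Suc i) = tl (g i) @ [c]" using step[of i] by (auto simp: walk_step_def)
    have "g i ! Suc j = tl (g i) ! j" using Suc.prems len[of i] by (simp add: nth_tl)
    also have "\<dots> = g (Suc i) ! j" 
    proof -
      have "j < length (tl (g i))" using Suc.prems len[of i] by simp
      then show ?thesis unfolding c by (simp add: nth_append)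
    qed
    also have "\<dots> = hd (g (Suc i + j))" using Suc by simp
    finally show ?case by simp
  qed
  define C where "C = Hypergraph {..<m} {{(i + j) mod m | j. j < t} | i. i < m}"
  define h where "h i = hd (f i)" for i
  have h: "h ` {(i + j) mod m | j. j < t} = set (g i)" for i
  proof -
    have "h ((i + j) mod m) = g i ! j" if "j < t" for j
      using nth[OF that] by (simp add: h_def g_def)
    then have "h ` (\<lambda>j. (i + j) mod m) ` {..<t} = (!) (g i) ` {..<t}"
      unfolding image_image by (intro image_cong) auto
    moreover have "{(i + j) mod m | j. j < t} = (\<lambda>j. (i + j) mod m) ` {..<t}" by auto
    moreover have "set (g i) = (!) (g i) ` {..<t}" using len[of i] by (auto simp: set_conv_nth)
    ultimately show ?thesis by simp
  qed
  have "uniform_cycle t C"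
    unfolding uniform_cycle_def
  proof (intro exI[of _ "[0..<m]"] conjI)
    show "edges C = {{[0..<m] ! ((i + j) mod length [0..<m]) | j. j < t} | i. i < length [0..<m]}"
      using m by (simp add: C_def)
  qed (use t in \<open>auto simp: C_def\<close>)
  moreover have "hypergraph_hom h C K"
    unfolding hypergraph_hom_def
  proof
    have "h i \<in> verts K" if "i < m" for i
    proof -
      have "g i \<noteq> []" using len[of i] t(1) by auto
      then have "hd (g i) \<in> set (g i)" by simp
      then show ?thesis using sub[OF edge[of i]] that by (auto simp: h_def g_def)
    qed
    then show "h ` verts C \<subseteq> verts K" by (auto simp: C_def)
    show "\<forall>e\<in>edges C. h ` e \<in> edges K" using h edge by (auto simp: C_def)
  qed
  ultimately have "closed_walk t K (Hypergraph (h ` verts C) ((`) h ` edges C)) m"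
    unfolding closed_walk_def by (intro exI[of _ C] exI[of _ h]) (simp add: C_def)
  then show ?thesis ..
qed

lemma walk_rotate:
  assumes "length xs = t" "0 < t" "set xs \<in> E"
  shows "(xs, rotate n xs) \<in> walk_step t E ^^ n"
proof (induction n)
  case (Suc n)
  let ?ys = "rotate n xs"
  have rot: "rotate (Suc n) xs = tl ?ys @ [hd ?ys]" 
  proof -
    have "?ys \<noteq> []" using assms by auto
    then show ?thesis by (simp add: rotate1_hd_tl)
  qed
  have "length ?ys = t" "set ?ys \<in> E" "set (tl ?ys @ [hd ?ys]) \<in> E"
    using assms unfolding rot[symmetric] by simp_all
  then have "(?ys, rotate (Suc n) xs) \<in> walk_step t E"
    unfolding rot walk_step_def by blast
  with Suc show ?case by (rule relpow_Suc_I)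
qed simp

text \<open>During one full round of \<open>t\<close> steps every vertex is appended again when its turn comes,
  except that \<open>c\<close> is appended in place of \<open>a\<close>. Each window seen on the way has the vertex set of the
  old or of the new tuple.\<close>

lemma walk_replace:
  assumes "length (us @ a # vs) = t" "set (us @ a # vs) \<in> E" "set (us @ c # vs) \<in> E"
  shows "(us @ a # vs, us @ c # vs) \<in> walk_step t E ^^ t"
proof -
  have t: "0 < t" using assms(1) by auto
  have "(us @ a # vs, a # vs @ us) \<in> walk_step t E ^^ length us"
    using walk_rotate[OF assms(1) t assms(2), of "length us"] by (simp add: rotate_append)
  moreover have "(a # vs @ us, vs @ us @ [c]) \<in> walk_step t E"
  proof -
    have "set (a # vs @ us) \<in> E" "set (vs @ us @ [c]) \<in> E" "length (a # vs @ us) = t"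
      using assms by (simp_all add: Un_commute)
    then show ?thesis unfolding walk_step_def by force
  qed
  ultimately have "(us @ a # vs, vs @ us @ [c]) \<in> walk_step t E ^^ Suc (length us)"
    by (rule relpow_Suc_I)
  moreover have "(vs @ us @ [c], us @ c # vs) \<in> walk_step t E ^^ length vs"
  proof -
    have "length (vs @ us @ [c]) = t" "set (vs @ us @ [c]) \<in> E"
      using assms by (simp_all add: Un_commute)
    from walk_rotate[OF this(1) t this(2), of "length vs"]
    show ?thesis by (simp add: rotate_append)
  qed
  ultimately have "(us @ a # vs, us @ c # vs) \<in> walk_step t E ^^ (Suc (length us) + length vs)"
    unfolding relpow_add by blast
  moreover have "Suc (length us) + length vs = t" using assms(1) by simp
  ultimately show ?thesis by (simp only:)
qed

text \<open>A switcher is an edge any two of whose \<open>(t - 1)\<close>-subsets have a common neighbour; it allows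
  two vertices of the edge to change places.\<close>

locale switcher =
  fixes t :: nat and E :: "'a set set" and X :: "'a set"
  assumes edge: "X \<in> E" and card_edge: "card X = t" and t_pos: "0 < t"
    and switch: "\<And>a b. a \<in> X \<Longrightarrow> b \<in> X \<Longrightarrow> a \<noteq> b \<Longrightarrow>
      \<exists>c. insert c (X - {a}) \<in> E \<and> insert c (X - {b}) \<in> E"
begin

text \<open>Three rounds of replacement, through a common neighbour \<open>c\<close>:
  \<open>(a, b)\<close>, \<open>(c, b)\<close>, \<open>(c, a)\<close>, \<open>(b, a)\<close>.\<close>

lemma walk_swap:
  assumes "set (us @ a # b # vs) = X" "distinct (us @ a # b # vs)"
  shows "(us @ a # b # vs, us @ b # a # vs) \<in> walk_step t E ^^ (t + t + t)"
proof -
  have len: "length (us @ a # b # vs) = t"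
    using assms card_edge distinct_card by metis
  have "a \<in> X" "b \<in> X" "a \<noteq> b" using assms by auto
  then obtain c where c: "insert c (X - {a}) \<in> E" "insert c (X - {b}) \<in> E"
    using switch by blast
  have "insert c (X - {a}) = set (us @ c # b # vs)" "insert c (X - {b}) = set (us @ c # a # vs)"
    using assms by auto
  then have e: "set (us @ c # b # vs) \<in> E" "set (us @ c # a # vs) \<in> E" using c by auto
  have X: "set (us @ a # b # vs) \<in> E" "set (us @ b # a # vs) \<in> E"
    using assms(1) edge by (simp_all add: insert_commute)
  have "(us @ a # b # vs, us @ c # b # vs) \<in> walk_step t E ^^ t"
    by (rule walk_replace[OF len X(1) e(1)])
  moreover have "(us @ c # b # vs, us @ c # a # vs) \<in> walk_step t E ^^ t"
    using walk_replace[of "us @ [c]" b vs t E a] len e by simp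
  moreover have "(us @ c # a # vs, us @ b # a # vs) \<in> walk_step t E ^^ t"
    by (rule walk_replace[OF _ e(2) X(2)]) (use len in simp)
  ultimately show ?thesis unfolding relpow_add by blast
qed

lemma walk_unrotate:
  assumes "set (us @ a # vs) = X" "distinct (us @ a # vs)"
  shows "\<exists>q. (us @ vs @ [a], us @ a # vs) \<in> walk_step t E ^^ (q * t)"
  using assms
proof (induction vs arbitrary: us)
  case Nil
  then show ?case by (intro exI[of _ 0]) simp
next
  case (Cons b vs)
  have "\<exists>q. ((us @ [b]) @ vs @ [a], (us @ [b]) @ a # vs) \<in> walk_step t E ^^ (q * t)"
    by (rule Cons.IH) (use Cons.prems in auto)
  then obtain q where q: "(us @ (b # vs) @ [a], us @ b # a # vs) \<in> walk_step t E ^^ (q * t)"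
    by auto
  have "(us @ b # a # vs, us @ a # b # vs) \<in> walk_step t E ^^ (t + t + t)"
    by (rule walk_swap) (use Cons.prems in auto)
  with q have "(us @ (b # vs) @ [a], us @ a # b # vs) \<in> walk_step t E ^^ (q * t + (t + t + t))"
    unfolding relpow_add by blast
  moreover have "q * t + (t + t + t) = (q + 3) * t" by (simp add: algebra_simps)
  ultimately show ?case by metis
qed

text \<open>One step rotates the tuple, and a multiple of \<open>t\<close> steps rotates it back. The additional
  round of \<open>t\<close> steps makes the walk longer than \<open>t\<close>, as the order of a cycle has to be.\<close>

lemma ex_loop:
  "\<exists>xs q. (xs, xs) \<in> walk_step t E ^^ (t + 1 + q * t)"
proof -
  have "finite X" using card_edge t_pos card_ge_0_finite by metis
  then obtain xs where xs: "set xs = X" "distinct xs" using finite_distinct_list by blast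
  have len: "length xs = t" using xs card_edge distinct_card by metis
  then obtain a vs where avs: "xs = a # vs" using t_pos by (cases xs) auto
  have "(xs, xs) \<in> walk_step t E ^^ t"
    using walk_rotate[OF len t_pos, of E t] xs(1) edge len by simp
  moreover have "(xs, vs @ [a]) \<in> walk_step t E ^^ 1"
    using walk_rotate[OF len t_pos, of E 1] xs(1) edge by (simp add: avs)
  moreover obtain q where "(vs @ [a], xs) \<in> walk_step t E ^^ (q * t)"
    using walk_unrotate[of "[]" a vs] xs by (auto simp: avs)
  ultimately have "(xs, xs) \<in> walk_step t E ^^ (t + 1 + q * t)"
    unfolding relpow_add by blast
  then show ?thesis by blast
qed

end

lemma ex_closed_walk_1_mod:
  assumes "switcher t (edges K) X" and "\<And>e. e \<in> edges K \<Longrightarrow> e \<subseteq> verts K"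
  shows "\<exists>W m. closed_walk t K W m \<and> [m = 1] (mod t)"
proof -
  interpret switcher t "edges K" X by fact
  obtain xs q where "(xs, xs) \<in> walk_step t (edges K) ^^ (t + 1 + q * t)"
    using ex_loop by blast
  then have "\<exists>W. closed_walk t K W (t + 1 + q * t)"
    by (rule closed_walk_of_walk_steps) (use t_pos assms(2) in auto)
  moreover have "[1 + (1 + q) * t = 1] (mod t)"
    by (simp only: unique_euclidean_semiring_class.cong_def mod_mult_self1)
  then have "[t + 1 + q * t = 1] (mod t)" by (simp add: algebra_simps)
  ultimately show ?thesis by blast
qed

lemma (in dense_kgraph) clique_switcher:
  assumes "X \<in> edges (clique_graph k t G)"
  shows "switcher t (edges (clique_graph k t G)) X"
proof
  have X: "clique k G X" "card X = t" using assms by (auto simp: edges_clique_graph)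
  show "X \<in> edges (clique_graph k t G)" "card X = t" "0 < t"
    using assms X k_ge_2 k_le_t by auto
  fix a b assume ab: "a \<in> X" "b \<in> X" "a \<noteq> b"
  have fin: "finite X" using finite_clique X(1) by blast
  have card: "card (X - {a}) = t - 1" "card (X - {b}) = t - 1"
    using X(2) ab fin by simp_all
  have "(X - {a}) \<inter> (X - {b}) = X - {a} - {b}" by blast
  moreover have "card (X - {a} - {b}) = t - 1 - 1"
    using card(1) ab card_Diff_singleton[of b "X - {a}"] by simp
  ultimately have cap: "card ((X - {a}) \<inter> (X - {b})) = t - 1 - 1" by (simp only:)
  have "card {a, b} \<le> card X" using ab fin by (intro card_mono) auto
  then have t: "1 \<le> t - 1" "t - 1 < t" using ab(3) X(2) by auto
  have cl: "clique k G (X - {a})" "clique k G (X - {b})" using clique_subset[OF X(1)] by blast+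
  from extend_clique_pair[OF cl card cap t]
  obtain w where w: "w \<notin> (X - {a}) \<union> (X - {b})"
    "clique k G (insert w (X - {a}))" "clique k G (insert w (X - {b}))" by blast
  then have "card (insert w (X - {a})) = t" "card (insert w (X - {b})) = t"
    using card fin t by simp_all
  then show "\<exists>c. insert c (X - {a}) \<in> edges (clique_graph k t G) \<and>
      insert c (X - {b}) \<in> edges (clique_graph k t G)"
    using w(2,3) unfolding edges_clique_graph by blast
qed

section \<open>Perfect fractional matchings\<close>

lemma compact_bounded_functions:
  fixes E :: "'b set" and c :: real
  shows "compact {w. (\<forall>e\<in>E. 0 \<le> w e \<and> w e \<le> c) \<and> (\<forall>e. e \<notin> E \<longrightarrow> w e = 0)}"
proof -
  let ?B = "\<lambda>e. if e \<in> E then {0..c} else {0}"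
  have "compactin (product_topology (\<lambda>_. euclidean) UNIV) (\<Pi>\<^sub>E e\<in>UNIV. ?B e)"
    unfolding compactin_PiE by auto
  then have "compact (\<Pi>\<^sub>E e\<in>UNIV. ?B e)"
    by (simp add: euclidean_product_topology)
  moreover have "(\<Pi>\<^sub>E e\<in>UNIV. ?B e) = {w. (\<forall>e\<in>E. 0 \<le> w e \<and> w e \<le> c) \<and> (\<forall>e. e \<notin> E \<longrightarrow> w e = 0)}"
    by (auto simp: PiE_iff split: if_splits)
  ultimately show ?thesis by simp
qed

text \<open>This direction of linear programming duality is obtained by minimising
  \<open>Q w = (\<Sum>v\<in>V. (exc w v)\<^sup>2)\<close>, where \<open>exc w v\<close> is the excess of the degree of \<open>v\<close> over \<open>1\<close>.
  At a minimiser \<open>w\<close> the excess \<open>y\<close> sums to \<open>0\<close>, so there is an edge \<open>e\<close> on which \<open>y\<close> has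
  nonpositive sum. Moving towards the weighting that is concentrated on \<open>e\<close> changes \<open>Q\<close> at a rate of
  at most \<open>- 2 Q w\<close>, which forces \<open>Q w = 0\<close>.\<close>

lemma fractional_matching_criterion:
  fixes V :: "'a set" and E :: "'a set set"
  assumes fin: "finite V" "finite E" and V: "V \<noteq> {}" and t: "0 < t"
    and sub: "\<And>e. e \<in> E \<Longrightarrow> e \<subseteq> V \<and> card e = t"
    and light: "\<And>y :: 'a \<Rightarrow> real. \<exists>e\<in>E. real (card V) * sum y e \<le> real t * sum y V"
  shows "\<exists>w. (\<forall>e\<in>E. 0 \<le> w e) \<and> (\<forall>v\<in>V. (\<Sum>e\<in>{e\<in>E. v \<in> e}. w e) = (1::real))"
proof -
  define n where "n = real (card V)"
  define r where "r = n / t"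
  define W where "W = {w :: 'a set \<Rightarrow> real. ((\<forall>e\<in>E. 0 \<le> w e \<and> w e \<le> r) \<and>
    (\<forall>e. e \<notin> E \<longrightarrow> w e = 0)) \<and> sum w E = r}"
  define exc where "exc w v = (\<Sum>e\<in>E. w e * indicator e v) - 1" for w :: "'a set \<Rightarrow> real" and v
  define Q where "Q w = (\<Sum>v\<in>V. (exc w v)\<^sup>2)" for w
  have n: "0 < n" using fin V by (simp add: n_def card_gt_0_iff)
  have r: "0 < r" "r * t = n" using n t by (simp_all add: r_def)
  have "closed {w :: 'a set \<Rightarrow> real. sum w E = r}"
    by (intro closed_Collect_eq continuous_intros continuous_on_product_coordinates)
  then have "compact W"
    unfolding W_def Collect_conj_eq
    using compact_Int_closed[OF compact_bounded_functions[of E "r"]] by (simp add: Collect_conj_eq)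
  obtain e0 where e0: "e0 \<in> E" using light by blast
  have "(\<lambda>e. if e = e0 then r else 0) \<in> W"
    using e0 fin r by (auto simp: W_def)
  then have "W \<noteq> {}" by blast
  have "continuous_on W Q"
    unfolding Q_def exc_def
    by (intro continuous_intros continuous_on_subset[OF continuous_on_product_coordinates]) auto
  from continuous_attains_inf[OF \<open>compact W\<close> \<open>W \<noteq> {}\<close> this]
  obtain w where w: "w \<in> W" and min: "\<And>w'. w' \<in> W \<Longrightarrow> Q w \<le> Q w'" by blast
  let ?y = "exc w"
  have sum_ind: "(\<Sum>v\<in>V. f v * indicator e v) = sum f e" if "e \<in> E" for e and f :: "'a \<Rightarrow> real"
    using sub[OF that] fin(1) sum.inter_restrict[OF fin(1), of f e]
    by (simp add: indicator_def if_distrib inf.absorb2 cong: if_cong)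
  have "sum ?y V = (\<Sum>v\<in>V. \<Sum>e\<in>E. w e * indicator e v) - n"
    by (simp add: exc_def sum_subtractf n_def)
  also have "(\<Sum>v\<in>V. \<Sum>e\<in>E. w e * indicator e v) = (\<Sum>e\<in>E. w e * t)"
  proof (subst sum.swap, rule sum.cong[OF refl])
    fix e assume "e \<in> E"
    then show "(\<Sum>v\<in>V. w e * indicator e v) = w e * t"
      using sum_ind[of e "\<lambda>_. w e"] sub[of e] by simp
  qed
  also have "\<dots> = n"
    using w r(2) unfolding sum_distrib_right[symmetric] by (simp add: W_def)
  finally have sum_y: "sum ?y V = 0" by simp
  obtain e where e: "e \<in> E" and "n * sum ?y e \<le> t * sum ?y V"
    using light[of ?y] unfolding n_def by blast
  then have y_e: "sum ?y e \<le> 0" using sum_y n by (simp add: mult_le_0_iff)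
  define d where "d v = r * indicator e v - (?y v + 1)" for v
  define M where "M = (\<Sum>v\<in>V. (d v)\<^sup>2)"
  have yd: "(\<Sum>v\<in>V. ?y v * d v) \<le> - Q w"
  proof -
    have "(\<Sum>v\<in>V. ?y v * d v) = (\<Sum>v\<in>V. r * (?y v * indicator e v) - (?y v)\<^sup>2 - ?y v)"
      by (rule sum.cong) (auto simp: d_def algebra_simps power2_eq_square)
    also have "\<dots> = r * sum ?y e - Q w - sum ?y V"
      by (simp add: sum_subtractf sum_distrib_left[symmetric] sum_ind[OF e] Q_def)
    also have "\<dots> \<le> - Q w"
      using sum_y y_e r(1) by (simp add: mult_le_0_iff)
    finally show ?thesis .
  qed
  have move: "2 * Q w \<le> s * M" if s: "0 < s" "s \<le> 1" for s
  proof -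
    define w' where "w' f = (1 - s) * w f + s * (if f = e then r else 0)" for f
    have delta: "(if f = e then r else 0) \<le> r" "0 \<le> (if f = e then r else 0)" for f
      using r(1) by auto
    have bound: "0 \<le> w' f \<and> w' f \<le> r" if "f \<in> E" for f
    proof -
      have "0 \<le> w f" "w f \<le> r" using w that by (auto simp: W_def)
      then have "0 \<le> w' f" unfolding w'_def
        using s delta(2) by (intro add_nonneg_nonneg mult_nonneg_nonneg) auto
      moreover have "w' f \<le> (1 - s) * r + s * r" unfolding w'_def
        using s delta(1) \<open>w f \<le> r\<close> by (intro add_mono mult_left_mono) auto
      ultimately show ?thesis by (simp add: algebra_simps)
    qed
    have "sum w' E = (1 - s) * sum w E + s * r"
      unfolding w'_def using e fin by (simp add: sum.distrib sum_distrib_left[symmetric])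
    also have "\<dots> = r" using w by (simp add: W_def algebra_simps)
    finally have "w' \<in> W" using bound w e by (auto simp: W_def w'_def)
    have "exc w' v = ?y v + s * d v" for v
    proof -
      have "(\<Sum>f\<in>E. w' f * indicator f v) =
        (\<Sum>f\<in>E. (1 - s) * (w f * indicator f v) + (if f = e then s * r * indicator e v else 0))"
        by (rule sum.cong) (auto simp: w'_def algebra_simps)
      also have "\<dots> = (1 - s) * (?y v + 1) + s * r * indicator e v"
        using e fin by (simp add: sum.distrib sum_distrib_left[symmetric] exc_def)
      finally show ?thesis by (simp add: exc_def d_def algebra_simps)
    qed
    then have "Q w' = (\<Sum>v\<in>V. (?y v)\<^sup>2 + 2 * s * (?y v * d v) + s\<^sup>2 * (d v)\<^sup>2)"
      unfolding Q_def by (intro sum.cong) (auto simp: power2_eq_square algebra_simps)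
    also have "\<dots> = Q w + 2 * s * (\<Sum>v\<in>V. ?y v * d v) + s\<^sup>2 * M"
      by (simp add: sum.distrib sum_distrib_left[symmetric] Q_def M_def)
    also have "\<dots> \<le> Q w + 2 * s * (- Q w) + s\<^sup>2 * M"
      using yd s by (intro add_mono mult_left_mono) auto
    finally have "s * (2 * Q w) \<le> s * (s * M)"
      using min[OF \<open>w' \<in> W\<close>] by (simp add: power2_eq_square)
    then show ?thesis using s by simp
  qed
  have "Q w \<le> 0"
  proof (rule ccontr)
    assume "\<not> Q w \<le> 0"
    then have Q: "0 < Q w" by simp
    have M: "0 \<le> M" unfolding M_def by (intro sum_nonneg) auto
    \<comment> \<open>This step length lies in \<open>{0<..1}\<close>, and it is short enough for the first order term to win.\<close>
    have "2 * Q w \<le> Q w / (M + Q w) * M"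
      by (rule move) (use Q M in \<open>auto simp: divide_simps\<close>)
    also have "\<dots> \<le> Q w" using Q M by (simp add: divide_simps)
    finally show False using Q by simp
  qed
  then have "(\<Sum>v\<in>V. (?y v)\<^sup>2) = 0" unfolding Q_def by (intro antisym sum_nonneg) auto
  then have "?y v = 0" if "v \<in> V" for v using that fin(1) by (simp add: sum_nonneg_eq_0_iff)
  moreover have "(\<Sum>e\<in>E. w e * indicator e v) = (\<Sum>e\<in>{e\<in>E. v \<in> e}. w e)" for v
    unfolding sum.inter_filter[OF fin(2)] by (intro sum.cong) (auto simp: indicator_def)
  ultimately have "\<forall>v\<in>V. (\<Sum>e\<in>{e\<in>E. v \<in> e}. w e) = 1" by (simp add: exc_def)
  moreover have "\<forall>e\<in>E. 0 \<le> w e" using w by (simp add: W_def)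
  ultimately show ?thesis by blast
qed

text \<open>The value at the start of each of \<open>t\<close> equal blocks is at most the average over that block.
  As \<open>t\<close> need not divide \<open>n\<close>, each index is repeated \<open>t\<close> times: the \<open>n t\<close> slots, slot \<open>s\<close>
  carrying \<open>u (s div t)\<close>, split into \<open>t\<close> blocks of length \<open>n\<close> as well as into \<open>n\<close> of length \<open>t\<close>.\<close>

lemma mono_sample_sum_le:
  fixes u :: "nat \<Rightarrow> real"
  assumes mono: "\<And>i j. i \<le> j \<Longrightarrow> j < n \<Longrightarrow> u i \<le> u j" and t: "0 < t"
  shows "real n * (\<Sum>i<t. u (i * n div t)) \<le> real t * (\<Sum>j<n. u j)"
proof -
  have "real n * (\<Sum>i<t. u (i * n div t)) = (\<Sum>i<t. \<Sum>s=i*n..<i*n+n. u (i * n div t))"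
    by (simp add: sum_distrib_left)
  also have "\<dots> \<le> (\<Sum>i<t. \<Sum>s=i*n..<i*n+n. u (s div t))"
  proof (intro sum_mono mono)
    fix i s assume i_s: "i \<in> {..<t}" "s \<in> {i*n..<i*n+n}"
    then show "i * n div t \<le> s div t" by (intro div_le_mono) simp
    have "s < (i + 1) * n" using i_s by simp
    also have "\<dots> \<le> t * n" using i_s by (intro mult_le_mono1) simp
    finally show "s div t < n" using t by (simp add: less_mult_imp_div_less mult.commute)
  qed
  also have "\<dots> = (\<Sum>s<n*t. u (s div t))"
    using sum.nat_group[of "\<lambda>s. u (s div t)" n t] by (simp add: mult.commute)
  also have "\<dots> = (\<Sum>j<n. \<Sum>s=j*t..<j*t+t. u (s div t))"
    using sum.nat_group[of "\<lambda>s. u (s div t)" t n] by simp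
  also have "\<dots> = (\<Sum>j<n. \<Sum>s=j*t..<j*t+t. u j)"
  proof (intro sum.cong refl)
    fix j s assume "s \<in> {j*t..<j*t+t}"
    then have "s div t = j" using t by (intro div_nat_eqI) (auto simp: algebra_simps)
    then show "u (s div t) = u j" by simp
  qed
  also have "\<dots> = real t * (\<Sum>j<n. u j)" by (simp add: sum_distrib_left)
  finally show ?thesis .
qed

context dense_kgraph
begin

text \<open>The next vertex is found among the positions \<open>0, \<dots>, i n div t\<close>, one position more than the
  number of vertices that may be forbidden or already used.\<close>

lemma clique_in_initial_segments:
  fixes vs :: "'a list"
  assumes vs: "distinct vs" "set vs = verts G"
    and mono: "\<And>i j. i \<le> j \<Longrightarrow> j < length vs \<Longrightarrow> y (vs ! i) \<le> (y (vs ! j) :: real)"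
    and "i \<le> t"
  shows "\<exists>X. clique k G X \<and> card X = i \<and> sum y X \<le> (\<Sum>l<i. y (vs ! (l * length vs div t)))"
  using assms(4)
proof (induction i)
  case 0
  show ?case using k_ge_2 by (intro exI[of _ "{}"]) (auto simp: clique_def)
next
  case (Suc i)
  from Suc.IH Suc.prems obtain X where X: "clique k G X" "card X = i"
    "sum y X \<le> (\<Sum>l<i. y (vs ! (l * length vs div t)))"
    by (meson Suc_leD)
  let ?n = "length vs" and ?D = "pair_subset_count k t"
  let ?q = "i * ?n div t"
  have t: "0 < t" using Suc.prems by simp
  have n: "card (verts G) = ?n" using vs distinct_card by metis
  have fX: "finite X" using finite_clique X(1) by blast
  have "?D * (b + t) > 0" using pair_subset_count_ge_2[OF k_ge_2 k_le_t] t by simp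
  then have npos: "0 < ?n" using many_vertices n by linarith
  have q: "?q < ?n"
  proof -
    have "i * ?n < t * ?n" using Suc.prems npos by simp
    then show ?thesis using t by (simp add: less_mult_imp_div_less mult.commute)
  qed
  let ?I = "(!) vs ` {..?q}"
  have "inj_on ((!) vs) {..?q}" using vs(1) q by (intro inj_on_nth) auto
  then have card_I: "card ?I = Suc ?q" by (simp add: card_image)
  have "((i choose (k - 1)) * b + i) * t \<le> i * ?n"
  proof -
    have "((i choose (k - 1)) * b + i) * t = (t * (i choose (k - 1))) * b + i * t"
      by (simp add: algebra_simps)
    also have "\<dots> \<le> (i * ?D) * b + i * t"
      using subset_count_le[OF k_ge_2 k_le_t] Suc.prems by (intro add_right_mono mult_le_mono1) simp
    also have "\<dots> \<le> (i * ?D) * b + i * (?D * t)"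
      using pair_subset_count_ge_2[OF k_ge_2 k_le_t] by (intro add_left_mono mult_le_mono2) simp
    also have "\<dots> = i * (?D * (b + t))" by (simp add: algebra_simps)
    also have "\<dots> \<le> i * ?n" using many_vertices n by simp
    finally show ?thesis .
  qed
  then have "(i choose (k - 1)) * b + i \<le> ?q" using t by (simp add: less_eq_div_iff_mult_less_eq)
  then have large: "(card X choose (k - 1)) * b + card (X \<union> {}) < card ?I"
    unfolding card_I X(2) by (simp add: X(2))
  have "?I \<subseteq> verts G" using q vs(2) by (auto intro!: nth_mem simp flip: vs(2))
  from extend_clique[OF X(1) finite.emptyI this large]
  obtain w where w: "w \<in> ?I" "w \<notin> X" "clique k G (insert w X)" by blast
  obtain l where l: "l \<le> ?q" "w = vs ! l" using w(1) by auto
  have "y w \<le> y (vs ! ?q)" unfolding l(2) using l(1) q by (intro mono)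
  then have "sum y (insert w X) \<le> (\<Sum>l<Suc i. y (vs ! (l * ?n div t)))"
    using w(2) fX X(3) by simp
  moreover have "card (insert w X) = Suc i" using w(2) fX X(2) by simp
  ultimately show ?case using w(3) by blast
qed

lemma ex_light_clique:
  fixes y :: "'a \<Rightarrow> real"
  shows "\<exists>X\<in>edges (clique_graph k t G). real (card (verts G)) * sum y X \<le> real t * sum y (verts G)"
proof -
  obtain us where us: "set us = verts G" "distinct us"
    using finite_distinct_list[OF finite_verts] by blast
  define vs where "vs = sort_key y us"
  have vs: "distinct vs" "set vs = verts G" using us by (simp_all add: vs_def)
  have sorted: "sorted (map y vs)" by (simp add: vs_def)
  have mono: "y (vs ! i) \<le> y (vs ! j)" if "i \<le> j" "j < length vs" for i j
    using sorted_nth_mono[OF sorted that(1)] that by simp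
  have t: "0 < t" using k_ge_2 k_le_t by simp
  obtain X where X: "clique k G X" "card X = t"
    "sum y X \<le> (\<Sum>l<t. y (vs ! (l * length vs div t)))"
    using clique_in_initial_segments[of vs y t, OF vs mono] by blast
  have "real (length vs) * sum y X \<le> real (length vs) * (\<Sum>l<t. y (vs ! (l * length vs div t)))"
    using X(3) by (intro mult_left_mono) auto
  also have "\<dots> \<le> real t * (\<Sum>j<length vs. y (vs ! j))"
    by (rule mono_sample_sum_le[OF mono t])
  also have "(\<Sum>j<length vs. y (vs ! j)) = sum y (verts G)"
    using sum.reindex_bij_betw[OF bij_betw_nth[OF vs(1) refl vs(2)[symmetric]], of y] by simp
  finally have "real (length vs) * sum y X \<le> real t * sum y (verts G)" .
  moreover have "length vs = card (verts G)" using vs distinct_card by metis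
  ultimately show ?thesis using X(1,2) by (auto simp: edges_clique_graph)
qed

lemma clique_graph_perfect_fractional_matching:
  "\<exists>w. perfect_fractional_matching t (clique_graph k t G) w"
proof -
  let ?E = "edges (clique_graph k t G)"
  have t: "0 < t" using k_ge_2 k_le_t by simp
  have sub: "e \<subseteq> verts G \<and> card e = t" if "e \<in> ?E" for e
    using that by (auto simp: edges_clique_graph clique_def)
  have fE: "finite ?E"
    by (rule finite_subset[of _ "Pow (verts G)"]) (use sub in auto)
  have "?E \<noteq> {}" using ex_light_clique by blast
  then have "verts G \<noteq> {}" using sub t by force
  from fractional_matching_criterion[OF finite_verts fE this t sub ex_light_clique]
  obtain w where w: "\<forall>e\<in>?E. 0 \<le> w e" "\<forall>v\<in>verts G. (\<Sum>e\<in>{e\<in>?E. v \<in> e}. w e) = (1::real)"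
    by blast
  have "w e \<le> 1" if e: "e \<in> ?E" for e
  proof -
    obtain v where v: "v \<in> e" using sub[OF e] t by fastforce
    have "w e \<le> (\<Sum>e\<in>{e\<in>?E. v \<in> e}. w e)"
      using e v w(1) fE by (intro member_le_sum) auto
    then show ?thesis using w(2) v sub[OF e] by auto
  qed
  moreover have "(\<Sum>e\<in>?E. w e) = real (card (verts G)) / real t"
  proof -
    have "real (card (verts G)) = (\<Sum>v\<in>verts G. \<Sum>e\<in>{e\<in>?E. v \<in> e}. w e)"
      using w(2) by simp
    also have "\<dots> = (\<Sum>e\<in>?E. \<Sum>v\<in>{v\<in>verts G. v \<in> e}. w e)"
      by (rule sum.swap_restrict[OF finite_verts fE])
    also have "\<dots> = (\<Sum>e\<in>?E. t * w e)"
    proof (rule sum.cong[OF refl])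
      fix e assume e: "e \<in> ?E"
      then have "{v \<in> verts G. v \<in> e} = e" using sub[OF e] by blast
      then show "(\<Sum>v\<in>{v\<in>verts G. v \<in> e}. w e) = t * w e" using sub[OF e] by simp
    qed
    finally show ?thesis using t by (simp add: sum_distrib_left[symmetric])
  qed
  ultimately show ?thesis using w
    by (intro exI[of _ w]) (simp add: perfect_fractional_matching_def fractional_matching_def)
qed

end

section \<open>From minimum degree to the Hamilton framework\<close>

lemma min_degree_le:
  assumes "kgraph k G" "S \<subseteq> verts G" "card S = d"
  shows "min_degree d G \<le> card {e \<in> edges G. S \<subseteq> e}"
proof -
  let ?P = "\<lambda>m. \<forall>S. S \<subseteq> verts G \<and> card S = d \<longrightarrow> m \<le> card {e \<in> edges G. S \<subseteq> e}"
  have "?P (Greatest ?P)"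
    by (rule GreatestI_nat[of ?P 0 "card {e \<in> edges G. S \<subseteq> e}"]) (use assms in auto)
  then show ?thesis using assms by (simp add: min_degree_def)
qed

lemma card_non_neighbours:
  assumes "kgraph k G" "0 < k" "S \<subseteq> verts G" "card S = k - 1"
  shows "card {w \<in> verts G - S. insert w S \<notin> edges G} + card {e \<in> edges G. S \<subseteq> e}
    = card (verts G) - (k - 1)"
proof -
  let ?N = "{w \<in> verts G - S. insert w S \<in> edges G}"
  let ?B = "{w \<in> verts G - S. insert w S \<notin> edges G}"
  have fin: "finite (verts G)" and edge: "\<And>e. e \<in> edges G \<Longrightarrow> e \<subseteq> verts G \<and> card e = k"
    using assms(1) by (auto simp: kgraph_def)
  have finS: "finite S" using fin assms(3) finite_subset by blast
  have "bij_betw (\<lambda>w. insert w S) ?N {e \<in> edges G. S \<subseteq> e}"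
  proof (rule bij_betwI')
    fix x y assume "x \<in> ?N" "y \<in> ?N"
    then show "(insert x S = insert y S) = (x = y)" by blast
  next
    fix e assume e: "e \<in> {e \<in> edges G. S \<subseteq> e}"
    then have "card (e - S) = 1"
      using edge[of e] assms(2,4) card_Diff_subset[OF finS, of e] by auto
    then obtain w where w: "e - S = {w}" by (rule card_1_singletonE)
    then have "w \<in> verts G - S" "e = insert w S" using e edge[of e] by auto
    then show "\<exists>w\<in>?N. e = insert w S" using e by blast
  qed auto
  then have "card ?N = card {e \<in> edges G. S \<subseteq> e}" by (rule bij_betw_same_card)
  moreover have "card ?B + card ?N = card (?B \<union> ?N)"
    by (rule card_Un_disjoint[symmetric]) (use fin in auto)
  moreover have "?B \<union> ?N = verts G - S" by blast
  moreover have "card (verts G - S) = card (verts G) - (k - 1)"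
    using card_Diff_subset[OF finS assms(3)] assms(4) by simp
  ultimately show ?thesis by simp
qed

text \<open>With \<open>m = n - (k - 1)\<close>, a \<open>(k - 1)\<close>-set has at most \<open>m / D - \<epsilon> m\<close> non-neighbours. The slack
  \<open>\<epsilon> m\<close> is at least \<open>t\<close> once \<open>n \<ge> k + t / \<epsilon>\<close>.\<close>

lemma dense_kgraph_of_min_degree:
  assumes k: "2 \<le> k" "k \<le> t" and \<epsilon>: "0 < \<epsilon>"
    and G: "kgraph k G" and large: "real k + real t / \<epsilon> \<le> real (card (verts G))"
    and deg: "(f_bound k t + \<epsilon>) * real ((card (verts G) - (k - 1)) choose (k - (k - 1)))
      \<le> real (min_degree (k - 1) G)"
  shows "dense_kgraph k t (card (verts G) div pair_subset_count k t - t) G"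
proof -
  define n where "n = card (verts G)"
  define D where "D = pair_subset_count k t"
  define m where "m = n - (k - 1)"
  have D: "2 \<le> D" using pair_subset_count_ge_2[OF k] by (simp add: D_def)
  have "0 \<le> real t / \<epsilon>" using \<epsilon> by simp
  then have "real k \<le> real n" using large unfolding n_def by linarith
  then have kn: "k \<le> n" by simp
  then have "real m = real n - real k + 1" using k(1) by (simp add: m_def of_nat_diff)
  then have "real t / \<epsilon> \<le> real m" using large unfolding n_def by linarith
  then have tm: "real t \<le> \<epsilon> * real m" using \<epsilon> by (simp add: divide_le_eq mult.commute)
  have deg': "(1 - 1 / real D + \<epsilon>) * real m \<le> real (min_degree (k - 1) G)"
    using deg k(1) unfolding f_bound_eq D_def m_def n_def by simp
  have bad: "card {w \<in> verts G - S. insert w S \<notin> edges G} + t \<le> n div D"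
    if S: "S \<subseteq> verts G" "card S = k - 1" for S
  proof -
    let ?b = "card {w \<in> verts G - S. insert w S \<notin> edges G}"
    have "?b + min_degree (k - 1) G \<le> m"
      using card_non_neighbours[OF G _ S] min_degree_le[OF G S] k(1) by (simp add: m_def n_def)
    then have "real ?b \<le> real m - (1 - 1 / real D + \<epsilon>) * real m" using deg' by linarith
    also have "\<dots> = real m / real D - \<epsilon> * real m" by (simp add: algebra_simps)
    also have "\<dots> \<le> real m / real D - real t" using tm by simp
    finally have "real D * (real ?b + real t) \<le> real D * (real m / real D)"
      using D by (intro mult_left_mono) auto
    then have "real (D * (?b + t)) \<le> real m" using D by simp
    then have "D * (?b + t) \<le> m" by (simp only: of_nat_le_iff)
    also have "\<dots> \<le> n" by (simp add: m_def)
    finally show ?thesis using D by (simp add: less_eq_div_iff_mult_less_eq mult.commute)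
  qed
  have "k - 1 \<le> card (verts G)" using kn by (simp add: n_def)
  from obtain_subset_with_card_n[OF this]
  obtain S where "S \<subseteq> verts G" "card S = k - 1" by blast
  from bad[OF this] have "t \<le> n div D" by simp
  then have "D * (n div D - t + t) \<le> n" by simp
  moreover have "card {w \<in> verts G - S. insert w S \<notin> edges G} \<le> n div D - t"
    if "S \<subseteq> verts G" "card S = k - 1" for S
    using bad[OF that] by linarith
  ultimately show ?thesis
    using k G unfolding D_def n_def by unfold_locales auto
qed

lemma clique_graph_hamilton_framework:
  assumes k: "2 \<le> k" "k \<le> t" and \<epsilon>: "0 < \<epsilon>" and n: "real k + real t / \<epsilon> \<le> real n"
  shows "hamilton_framework t n (clique_graph_family (k - 1) k t (f_bound k t + \<epsilon>) n) (\<lambda>K. K)"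
proof -
  define b where "b = n div pair_subset_count k t - t"
  have family: "\<exists>G. K = clique_graph k t G \<and> card (verts G) = n \<and> dense_kgraph k t b G"
    if "K \<in> clique_graph_family (k - 1) k t (f_bound k t + \<epsilon>) n" for K
  proof -
    obtain G where G: "K = clique_graph k t G" "kgraph k G" "card (verts G) = n"
      "(f_bound k t + \<epsilon>) * real ((n - (k - 1)) choose (k - (k - 1))) \<le> real (min_degree (k - 1) G)"
      using \<open>K \<in> _\<close> by (auto simp: clique_graph_family_def)
    then have "dense_kgraph k t b G"
      using dense_kgraph_of_min_degree[OF k \<epsilon> G(2)] n by (simp add: b_def)
    then show ?thesis using G by blast
  qed
  have "kgraph t K \<and> card (verts K) = n \<and> subgraph K K \<and> tight_component t K K \<and>
      (\<exists>w. perfect_fractional_matching t K w) \<and> (\<exists>W m. closed_walk t K W m \<and> [m = 1] (mod t))"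
    if K: "K \<in> clique_graph_family (k - 1) k t (f_bound k t + \<epsilon>) n" for K
  proof -
    from family[OF K] obtain G where G: "K = clique_graph k t G" "card (verts G) = n"
      "dense_kgraph k t b G" by blast
    interpret dense_kgraph k t b G by fact
    obtain X where "X \<in> cliques t" using cliques_nonempty by blast
    then have "\<exists>W m. closed_walk t K W m \<and> [m = 1] (mod t)"
      unfolding G(1) by (intro ex_closed_walk_1_mod clique_switcher) (auto simp: edges_clique_graph clique_def)
    moreover have "subgraph K K" unfolding G(1) by (auto simp: subgraph_def edges_clique_graph clique_def)
    ultimately show ?thesis
      using clique_graph_kgraph clique_graph_tight_component clique_graph_perfect_fractional_matching G(2)
      unfolding G(1) by simp
  qed
  moreover have "tightly_connected t H (graph_union K K')"
    if "K \<in> clique_graph_family (k - 1) k t (f_bound k t + \<epsilon>) n"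
      "K' \<in> clique_graph_family (k - 1) k t (f_bound k t + \<epsilon>) n"
      "v \<noteq> v'" "K = delete_vertex H v" "K' = delete_vertex H v'" for K K' H v v'
    using family[OF that(1)] family[OF that(2)] that(3-5) tightly_connected_union_delete_vertex by metis
  ultimately show ?thesis unfolding hamilton_framework_def by blast
qed

theorem theorem2p10:
  fixes k t :: nat
  assumes "2 \<le> k" and "k \<le> t"
  shows "HF_threshold (k - 1) k t \<le> f_bound k t"
  unfolding HF_threshold_def
proof (rule cInf_lower)
  have "\<exists>n0. \<forall>n\<ge>n0. \<exists>F. hamilton_framework t n
      (clique_graph_family (k - 1) k t (f_bound k t + \<epsilon>) n) F" if "0 < \<epsilon>" for \<epsilon>
  proof (intro exI allI impI)
    fix n assume "nat \<lceil>real k + real t / \<epsilon>\<rceil> \<le> n"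
    then have "real k + real t / \<epsilon> \<le> real n" by linarith
    then show "hamilton_framework t n
      (clique_graph_family (k - 1) k t (f_bound k t + \<epsilon>) n) (\<lambda>K. K)"
      using clique_graph_hamilton_framework[OF assms that] by blast
  qed
  moreover have "0 \<le> f_bound k t" "f_bound k t \<le> 1"
    using pair_subset_count_ge_2[OF assms] by (simp_all add: f_bound_eq divide_le_eq)
  ultimately show "f_bound k t \<in> {\<delta>. 0 \<le> \<delta> \<and> \<delta> \<le> 1 \<and>
     (\<forall>\<epsilon>>0. \<exists>n0. \<forall>n\<ge>n0. \<exists>F. hamilton_framework t n (clique_graph_family (k - 1) k t (\<delta> + \<epsilon>) n) F)}"
    by blast
qed (auto intro: bdd_belowI[of _ 0])

end
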